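(* Let $\nu$ be a $\sigma$-finite measure on a compact metric space $(T,\rho)$ and let $X=\{X(t),t\in T\}$ be a measurable random process from the space $\mathbf F_\psi(\Omega)$. Suppose that for some $p\ge1$ $$\int_T\|X(t)\|_\psi^p\,d\nu(t)<\infty.$$ Then: 1. with probability one the integral $\int_T|X(t)|^p\,d\nu(t)$ exists and $$\left\|\left(\int_T|X(t)|^p\,d\nu(t)\right)^{1/p}\right\|_\psi\le\frac{\psi(p)}{\psi(1)}\left(\int_T\|X(t)\|_\psi^p\,d\nu(t)\right)^{1/p};$$ 2. for any $\varepsilon>0$ $$P\left\{\left(\int_T|X(t)|^p\,d\nu(t)\right)^{1/p}>\varepsilon\right\}\le\inf_{u\ge1}\frac{\left(\frac{\psi(p)}{\psi(1)}\right)^u\left(\int_T\|X(t)\|_\psi^p\,d\nu(t)\right)^{u/p}(\psi(u))^u}{\varepsilon^u}.$$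
   Context: $\psi(u)>0$, $u\ge1$, is a monotonically increasing continuous function with $\psi(u)\to\infty$ as $u\to\infty$. $\mathbf F_\psi(\Omega)$ is the Banach space of random variables with norm $\|\xi\|_\psi=\sup_{u\ge1}\frac{(E|\xi|^u)^{1/u}}{\psi(u)}<\infty$. A process belongs to $\mathbf F_\psi(\Omega)$ if $X(t)\in\mathbf F_\psi(\Omega)$ for every $t\in T$. *)

theory Defs
  imports "HOL-Probability.Probability"
begin

text \<open>
  Random variables are functions rather than almost-everywhere classes, so
  \<open>F_norm\<close> is a seminorm on \<open>F_space\<close>. Outside \<open>F_space\<close> the real-valued
  integral and supremum in \<open>F_norm\<close> carry no meaning; \<open>F_space\<close> therefore demands
  that all the moments exist and that the supremum is finite.
\<close>

definition F_norm :: "'b measure \<Rightarrow> (real \<Rightarrow> real) \<Rightarrow> ('b \<Rightarrow> real) \<Rightarrow> real" where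
  "F_norm M \<psi> \<xi> = (SUP u\<in>{1..}. (\<integral>\<omega>. \<bar>\<xi> \<omega>\<bar> powr u \<partial>M) powr (1 / u) / \<psi> u)"

definition F_space :: "'b measure \<Rightarrow> (real \<Rightarrow> real) \<Rightarrow> ('b \<Rightarrow> real) set" where
  "F_space M \<psi> = {\<xi> \<in> borel_measurable M.
     (\<forall>u\<ge>1. integrable M (\<lambda>\<omega>. \<bar>\<xi> \<omega>\<bar> powr u)) \<and>
     bdd_above ((\<lambda>u. (\<integral>\<omega>. \<bar>\<xi> \<omega>\<bar> powr u \<partial>M) powr (1 / u) / \<psi> u) ` {1..})}"

text \<open>
  Where \<open>\<lambda>t. \<bar>X t \<omega>\<bar> powr p\<close> is not \<open>\<nu>\<close>-integrable, the Bochner integral, and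
  hence \<open>path_Lp_norm\<close>, takes the value 0.
\<close>

definition path_Lp_norm :: "'a measure \<Rightarrow> real \<Rightarrow> ('a \<Rightarrow> 'b \<Rightarrow> real) \<Rightarrow> 'b \<Rightarrow> real" where
  "path_Lp_norm \<nu> p X \<omega> = (\<integral>t. \<bar>X t \<omega>\<bar> powr p \<partial>\<nu>) powr (1 / p)"

end

theory Submission
  imports Defs
begin

text \<open>
  Let \<open>A\<close> be the integral of \<open>\<parallel>X(t)\<parallel>\<^sub>\<psi>\<^sup>p\<close> and \<open>Y\<close> the path norm.  The theorem reduces to moment bounds:
  the norm of \<open>F_space\<close> is at most a constant \<open>B\<close> once every moment of order \<open>u \<ge> 1\<close> is at most
  \<open>(\<psi>(u) B)\<^sup>u\<close>, and Markov's inequality turns the same bounds into the tail estimate.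

  For \<open>u \<ge> p\<close>, Minkowski's integral inequality in \<open>L\<^sup>r(M)\<close> with exponent \<open>r = u/p \<ge> 1\<close>, applied to
  \<open>|X(t)|\<^sup>p\<close>, bounds the \<open>L\<^sup>u\<close> norm of \<open>Y\<close> by \<open>\<psi>(u) A powr (1 / p)\<close> (\<open>Minkowski_integral_bound\<close>).  For
  \<open>1 \<le> u < p\<close> the \<open>L\<^sup>u\<close> norm is at most the \<open>L\<^sup>p\<close> norm, hence at most \<open>\<psi>(p) A powr (1 / p)\<close>
  (\<open>moment_le_higher_moment\<close>), and monotonicity gives \<open>\<psi>(p) \<le> \<psi>(u) \<psi>(p)/\<psi>(1)\<close>.  The factor
  \<open>\<psi>(p)/\<psi>(1) \<ge> 1\<close> is the price of the second range and covers the first one as well.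

  Both inequalities between moments come from Jensen's inequality for \<open>x\<^sup>r\<close> with respect to a
  weight (\<open>weighted_Jensen\<close>).  For Minkowski's inequality the weight is the pointwise moment bound
  \<open>g\<close> itself: then the expectation of the right-hand side is, by Tonelli's theorem,
  at most an expression in the integral of \<open>g\<close> alone.
\<close>

section \<open>Jensen's inequality with a weight\<close>

text \<open>
  The convex function \<open>x\<^sup>r\<close> lies above its tangent at \<open>1\<close>; the bound is this fact for
  \<open>x = f / (c g)\<close>, cleared of denominators. The parameter \<open>c\<close> moves the point of tangency of
  \<open>f / g\<close>.
\<close>

lemma powr_tangent_bound:
  fixes f g c r :: real
  assumes "1 \<le> r" "0 \<le> f" "0 \<le> g" "0 < c" "g = 0 \<Longrightarrow> f = 0"
  shows "r * f \<le> c powr (1 - r) * (f powr r / g powr (r - 1)) + (r - 1) * c * g"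
proof (cases "f = 0")
  case True
  then show ?thesis using assms by simp
next
  case False
  then have f: "0 < f" and g: "0 < g" using assms(2,3,5) by (auto simp: less_le)
  define x where "x = f / (g * c)"
  have x: "0 < x" using f g assms(4) by (simp add: x_def)
  have "(x powr r) powr (1 / r) * 1 powr (1 - 1 / r) \<le> 1 / r * x powr r + (1 - 1 / r) * 1"
    by (rule Youngs_inequality_0) (use assms(1) x in \<open>auto simp: field_simps\<close>)
  then have "x \<le> 1 / r * x powr r + (1 - 1 / r)"
    using assms(1) x by (simp add: powr_powr)
  then have "r * x \<le> r * (1 / r * x powr r + (1 - 1 / r))"
    using assms(1) by (intro mult_left_mono) auto
  also have "\<dots> = x powr r + (r - 1)" using assms(1) by (simp add: algebra_simps)
  finally have "r * x \<le> x powr r + (r - 1)" .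
  then have "(r * x) * (g * c) \<le> (x powr r + (r - 1)) * (g * c)"
    using g assms(4) by (intro mult_right_mono) auto
  moreover have "x powr r * (g * c) = c powr (1 - r) * (f powr r / g powr (r - 1))"
    using f g assms(4) by (simp add: x_def powr_divide powr_mult powr_diff field_simps)
  moreover have "x * (g * c) = f" using g assms(4) by (simp add: x_def)
  moreover have "(r * x) * (g * c) = r * (x * (g * c))"
    and "(x powr r + (r - 1)) * (g * c) = x powr r * (g * c) + (r - 1) * c * g"
    by (simp_all add: algebra_simps)
  ultimately show ?thesis by simp
qed

text \<open>
  This is Jensen's inequality for the mean of \<open>f / g\<close> under the measure with density \<open>g\<close>.
  The inequality is the integral of the tangent bound at that mean; the tangent at \<open>1\<close> dominates \<open>f\<close>
  and makes it integrable. The quotient is taken in the extended reals so that finiteness of its integral forces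
  \<open>f\<close> to vanish almost everywhere on the zero set of \<open>g\<close>. This works even for \<open>r = 1\<close>, because
  \<open>0 powr 0 = 0\<close>.
\<close>

lemma weighted_Jensen:
  fixes f g :: "'a \<Rightarrow> real" and r :: real
  assumes r: "1 \<le> r"
    and f [measurable]: "f \<in> borel_measurable N" and f0: "\<And>t. t \<in> space N \<Longrightarrow> 0 \<le> f t"
    and g: "integrable N g" and g0: "\<And>t. t \<in> space N \<Longrightarrow> 0 \<le> g t"
    and fin: "(\<integral>\<^sup>+t. ennreal (f t powr r) / ennreal (g t powr (r - 1)) \<partial>N) < \<top>"
  shows "integrable N f"
    and "ennreal ((\<integral>t. f t \<partial>N) powr r) \<le> ennreal ((\<integral>t. g t \<partial>N) powr (r - 1)) *
      (\<integral>\<^sup>+t. ennreal (f t powr r) / ennreal (g t powr (r - 1)) \<partial>N)" (is ?ineq)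
proof -
  have [measurable]: "g \<in> borel_measurable N" using g by auto
  define k where "k t = f t powr r / g t powr (r - 1)" for t
  have [measurable]: "k \<in> borel_measurable N" unfolding k_def by measurable
  have k0: "0 \<le> k t" for t by (simp add: k_def)
  have "AE t in N. ennreal (f t powr r) / ennreal (g t powr (r - 1)) \<noteq> \<top>"
    using nn_integral_PInf_AE[OF _ fin[THEN less_imp_neq, folded infinity_ennreal_def]]
    by simp
  then have zero: "AE t in N. g t = 0 \<longrightarrow> f t = 0"
  proof eventually_elim
    case (elim t)
    then show ?case
      by (cases "f t = 0") (auto simp: ennreal_divide_eq_top_iff)
  qed
  have "AE t in N. ennreal (f t powr r) / ennreal (g t powr (r - 1)) = ennreal (k t)"
    using zero AE_space
  proof eventually_elim
    case (elim t)
    then show ?case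
      using g0[of t] by (cases "g t = 0") (auto simp: k_def divide_ennreal)
  qed
  then have K: "(\<integral>\<^sup>+t. ennreal (f t powr r) / ennreal (g t powr (r - 1)) \<partial>N) = (\<integral>\<^sup>+t. k t \<partial>N)"
    by (rule nn_integral_cong_AE)
  have k: "integrable N k"
    by (rule integrableI_nonneg) (use fin K k0 in auto)
  have bound: "AE t in N. r * f t \<le> c powr (1 - r) * k t + (r - 1) * c * g t" if "0 < c" for c
    using zero AE_space
  proof eventually_elim
    case (elim t)
    then show ?case unfolding k_def by (intro powr_tangent_bound r f0 g0 that) auto
  qed
  show intf: "integrable N f"
  proof (rule Bochner_Integration.integrable_bound)
    show "integrable N (\<lambda>t. k t + (r - 1) * g t)" using k g by auto
    show "AE t in N. norm (f t) \<le> norm (k t + (r - 1) * g t)"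
      using bound[of 1, simplified] AE_space
    proof eventually_elim
      case (elim t)
      have "f t \<le> r * f t" using f0[OF elim(2)] r by (simp add: mult_le_cancel_right1)
      then show ?case using elim f0[OF elim(2)] by simp
    qed
  qed measurable
  let ?S = "\<integral>t. f t \<partial>N" and ?G = "\<integral>t. g t \<partial>N" and ?K = "\<integral>t. k t \<partial>N"
  have S0: "0 \<le> ?S" using f0 by (auto intro!: integral_nonneg_AE)
  have G0: "0 \<le> ?G" using g0 by (auto intro!: integral_nonneg_AE)
  have "?S powr r \<le> ?G powr (r - 1) * ?K"
  proof (cases "?S = 0")
    case True
    then show ?thesis using k0 by simp
  next
    case False
    have "?G \<noteq> 0"
    proof
      assume "?G = 0"
      then have "AE t in N. g t = 0"
        using integral_nonneg_eq_0_iff_AE[OF g] g0 by auto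
      then have "AE t in N. f t = 0" using zero by eventually_elim auto
      then show False using False integral_eq_zero_AE by blast
    qed
    then have S: "0 < ?S" and G: "0 < ?G" using S0 G0 False by auto
    \<comment> \<open>The tangent is taken at the mean of \<open>f / g\<close> with respect to the weight \<open>g\<close>.\<close>
    define c where "c = ?S / ?G"
    have c: "0 < c" using S G by (simp add: c_def)
    have "(\<integral>t. r * f t \<partial>N) \<le> (\<integral>t. c powr (1 - r) * k t + (r - 1) * c * g t \<partial>N)"
      by (rule integral_mono_AE) (use intf k g bound[OF c] in auto)
    then have "r * ?S \<le> c powr (1 - r) * ?K + (r - 1) * c * ?G"
      using intf k g by simp
    moreover have "c * ?G = ?S" using G by (simp add: c_def)
    ultimately have "?S \<le> c powr (1 - r) * ?K"
      by (simp add: mult.assoc left_diff_distrib)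
    then have "?S * ?S powr (r - 1) \<le> c powr (1 - r) * ?K * ?S powr (r - 1)"
      by (rule mult_right_mono) simp
    moreover have "?S * ?S powr (r - 1) = ?S powr r" using S by (simp add: powr_diff)
    moreover have "c powr (1 - r) * ?K * ?S powr (r - 1) = ?G powr (r - 1) * ?K"
      using S G by (simp add: c_def powr_divide powr_diff field_simps)
    ultimately show ?thesis by simp
  qed
  then show ?ineq
    using k0 by (simp add: K nn_integral_eq_integral[OF k] flip: ennreal_mult)
qed

section \<open>Minkowski's integral inequality\<close>

text \<open>
  Jensen's inequality with weight \<open>g\<close> in the variable \<open>t\<close> bounds the \<open>r\<close>-th power of the inner
  integral, for almost every \<open>\<omega>\<close>, by a power of the integral of \<open>g\<close> times the integral of
  \<open>f powr r / g powr (r - 1)\<close>. The expectation of the latter is computed under the integral over \<open>t\<close>,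
  where the moment hypothesis bounds it by \<open>g powr r / g powr (r - 1) = g\<close>.
\<close>

lemma Minkowski_integral_bound:
  fixes f :: "'a \<Rightarrow> 'b \<Rightarrow> real" and g :: "'a \<Rightarrow> real" and r :: real
  assumes sf: "sigma_finite_measure N" "sigma_finite_measure M"
    and r: "1 \<le> r"
    and f: "(\<lambda>(t, \<omega>). f t \<omega>) \<in> borel_measurable (N \<Otimes>\<^sub>M M)"
    and f0: "\<And>t \<omega>. 0 \<le> f t \<omega>"
    and g: "integrable N g" and g0: "\<And>t. t \<in> space N \<Longrightarrow> 0 \<le> g t"
    and mom: "\<And>t. t \<in> space N \<Longrightarrow> (\<integral>\<^sup>+\<omega>. ennreal (f t \<omega> powr r) \<partial>M) \<le> ennreal (g t powr r)"
  shows "AE \<omega> in M. integrable N (\<lambda>t. f t \<omega>)"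
    and "(\<integral>\<^sup>+\<omega>. ennreal ((\<integral>t. f t \<omega> \<partial>N) powr r) \<partial>M) \<le> ennreal ((\<integral>t. g t \<partial>N) powr r)"
proof -
  interpret N: sigma_finite_measure N by fact
  interpret M: sigma_finite_measure M by fact
  interpret pair_sigma_finite N M ..
  have [measurable]: "g \<in> borel_measurable N" using g by auto
  note f [measurable]
  define h where "h t \<omega> = ennreal (f t \<omega> powr r) / ennreal (g t powr (r - 1))" for t \<omega>
  have h [measurable]: "(\<lambda>(t, \<omega>). h t \<omega>) \<in> borel_measurable (N \<Otimes>\<^sub>M M)"
    unfolding h_def by measurable
  let ?G = "\<integral>t. g t \<partial>N"
  have G0: "0 \<le> ?G" using g0 by (auto intro!: integral_nonneg_AE)
  have inner: "(\<integral>\<^sup>+\<omega>. h t \<omega> \<partial>M) \<le> ennreal (g t)" if t: "t \<in> space N" for t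
  proof -
    have [measurable]: "(\<lambda>\<omega>. f t \<omega>) \<in> borel_measurable M"
      using measurable_Pair2[OF f t] by simp
    have "(\<integral>\<^sup>+\<omega>. h t \<omega> \<partial>M) = (\<integral>\<^sup>+\<omega>. ennreal (f t \<omega> powr r) \<partial>M) / ennreal (g t powr (r - 1))"
      unfolding h_def by (rule nn_integral_divide) measurable
    also have "\<dots> \<le> ennreal (g t powr r) / ennreal (g t powr (r - 1))"
      by (rule divide_right_mono_ennreal) (rule mom[OF t])
    \<comment> \<open>Where \<open>g t = 0\<close> this is \<open>0 / 0 = 0\<close> in the extended reals.\<close>
    also have "\<dots> = ennreal (g t)"
      using g0[OF t] by (cases "g t = 0") (auto simp: divide_ennreal powr_diff)
    finally show ?thesis .
  qed
  have "(\<integral>\<^sup>+\<omega>. \<integral>\<^sup>+t. h t \<omega> \<partial>N \<partial>M) = (\<integral>\<^sup>+t. \<integral>\<^sup>+\<omega>. h t \<omega> \<partial>M \<partial>N)"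
    by (rule Fubini'[OF h])
  also have "\<dots> \<le> (\<integral>\<^sup>+t. g t \<partial>N)" by (rule nn_integral_mono) (rule inner)
  also have "\<dots> = ennreal ?G" using g g0 by (intro nn_integral_eq_integral) auto
  finally have total: "(\<integral>\<^sup>+\<omega>. \<integral>\<^sup>+t. h t \<omega> \<partial>N \<partial>M) \<le> ennreal ?G" .
  have "AE \<omega> in M. (\<integral>\<^sup>+t. h t \<omega> \<partial>N) \<noteq> \<infinity>"
    by (rule nn_integral_PInf_AE) (use total in \<open>auto simp: top_unique\<close>)
  then have fin: "AE \<omega> in M. (\<integral>\<^sup>+t. h t \<omega> \<partial>N) < \<top>"
    by eventually_elim (auto simp: top.not_eq_extremum)
  have fm: "(\<lambda>t. f t \<omega>) \<in> borel_measurable N" if "\<omega> \<in> space M" for \<omega>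
    using measurable_Pair1[OF f that] by simp
  show "AE \<omega> in M. integrable N (\<lambda>t. f t \<omega>)"
    using fin AE_space
  proof eventually_elim
    case (elim \<omega>)
    show ?case
      by (rule weighted_Jensen(1)[OF r fm f0 g g0]) (use elim in \<open>auto simp: h_def\<close>)
  qed
  have "AE \<omega> in M. ennreal ((\<integral>t. f t \<omega> \<partial>N) powr r) \<le>
      ennreal (?G powr (r - 1)) * (\<integral>\<^sup>+t. h t \<omega> \<partial>N)"
    using fin AE_space
  proof eventually_elim
    case (elim \<omega>)
    show ?case unfolding h_def
      by (rule weighted_Jensen(2)[OF r fm f0 g g0]) (use elim in \<open>auto simp: h_def\<close>)
  qed
  then have "(\<integral>\<^sup>+\<omega>. ennreal ((\<integral>t. f t \<omega> \<partial>N) powr r) \<partial>M)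
      \<le> (\<integral>\<^sup>+\<omega>. ennreal (?G powr (r - 1)) * (\<integral>\<^sup>+t. h t \<omega> \<partial>N) \<partial>M)"
    by (rule nn_integral_mono_AE)
  also have "\<dots> = ennreal (?G powr (r - 1)) * (\<integral>\<^sup>+\<omega>. \<integral>\<^sup>+t. h t \<omega> \<partial>N \<partial>M)"
    by (rule nn_integral_cmult) measurable
  also have "\<dots> \<le> ennreal (?G powr (r - 1)) * ennreal ?G"
    by (rule mult_left_mono[OF total]) simp
  also have "\<dots> = ennreal (?G powr r)"
    using G0 by (cases "?G = 0") (auto simp: powr_diff simp flip: ennreal_mult)
  finally show "(\<integral>\<^sup>+\<omega>. ennreal ((\<integral>t. f t \<omega> \<partial>N) powr r) \<partial>M) \<le> ennreal (?G powr r)" .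
qed

section \<open>Moments and the norm of the space\<close>

lemma powr_inverse_le_iff:
  fixes a b u :: real
  assumes "0 < u" "0 \<le> a" "0 \<le> b"
  shows "a powr (1 / u) \<le> b \<longleftrightarrow> a \<le> b powr u"
proof
  assume "a powr (1 / u) \<le> b"
  then have "(a powr (1 / u)) powr u \<le> b powr u"
    using assms by (intro powr_mono2) auto
  then show "a \<le> b powr u" using assms by (simp add: powr_powr)
next
  assume "a \<le> b powr u"
  then have "a powr (1 / u) \<le> (b powr u) powr (1 / u)"
    using assms by (intro powr_mono2) auto
  then show "a powr (1 / u) \<le> b" using assms by (simp add: powr_powr)
qed

text \<open>
  The next two lemmas translate between the norm, a supremum of real-valued integrals that is meaningful
  only on \<open>F_space\<close>, and bounds on extended-real moments, from which integrability can be concluded.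
\<close>

lemma F_space_moment_le:
  assumes \<psi>: "\<And>u. 1 \<le> u \<Longrightarrow> 0 < \<psi> u" and \<xi>: "\<xi> \<in> F_space M \<psi>" and u: "1 \<le> u"
  shows "0 \<le> F_norm M \<psi> \<xi>"
    and "(\<integral>\<^sup>+\<omega>. ennreal (\<bar>\<xi> \<omega>\<bar> powr u) \<partial>M) \<le> ennreal ((\<psi> u * F_norm M \<psi> \<xi>) powr u)"
proof -
  let ?q = "\<lambda>u. (\<integral>\<omega>. \<bar>\<xi> \<omega>\<bar> powr u \<partial>M) powr (1 / u) / \<psi> u"
  have q: "?q u \<le> F_norm M \<psi> \<xi>"
    unfolding F_norm_def using \<xi> u by (intro cSUP_upper) (auto simp: F_space_def)
  have "0 \<le> ?q u" using \<psi>[OF u] by simp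
  with q show F0: "0 \<le> F_norm M \<psi> \<xi>" by linarith
  have "(\<integral>\<omega>. \<bar>\<xi> \<omega>\<bar> powr u \<partial>M) powr (1 / u) \<le> \<psi> u * F_norm M \<psi> \<xi>"
    using q \<psi>[OF u] by (simp add: field_simps)
  then have "(\<integral>\<omega>. \<bar>\<xi> \<omega>\<bar> powr u \<partial>M) \<le> (\<psi> u * F_norm M \<psi> \<xi>) powr u"
    using u F0 \<psi>[OF u] by (subst (asm) powr_inverse_le_iff) auto
  moreover have "integrable M (\<lambda>\<omega>. \<bar>\<xi> \<omega>\<bar> powr u)" using \<xi> u by (simp add: F_space_def)
  ultimately show "(\<integral>\<^sup>+\<omega>. ennreal (\<bar>\<xi> \<omega>\<bar> powr u) \<partial>M) \<le> ennreal ((\<psi> u * F_norm M \<psi> \<xi>) powr u)"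
    by (simp add: nn_integral_eq_integral ennreal_leI)
qed

lemma F_spaceI_moment_le:
  assumes \<psi>: "\<And>u. 1 \<le> u \<Longrightarrow> 0 < \<psi> u" and \<xi> [measurable]: "\<xi> \<in> borel_measurable M" and B: "0 \<le> B"
    and mom: "\<And>u. 1 \<le> u \<Longrightarrow> (\<integral>\<^sup>+\<omega>. ennreal (\<bar>\<xi> \<omega>\<bar> powr u) \<partial>M) \<le> ennreal ((\<psi> u * B) powr u)"
  shows "\<xi> \<in> F_space M \<psi>" and "F_norm M \<psi> \<xi> \<le> B"
proof -
  have int: "integrable M (\<lambda>\<omega>. \<bar>\<xi> \<omega>\<bar> powr u)" if u: "1 \<le> u" for u
    by (rule integrableI_nonneg) (use le_less_trans[OF mom[OF u] ennreal_less_top] in auto)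
  have q: "(\<integral>\<omega>. \<bar>\<xi> \<omega>\<bar> powr u \<partial>M) powr (1 / u) / \<psi> u \<le> B" if u: "1 \<le> u" for u
  proof -
    have "(\<integral>\<omega>. \<bar>\<xi> \<omega>\<bar> powr u \<partial>M) \<le> (\<psi> u * B) powr u"
      using mom[OF u] by (simp add: nn_integral_eq_integral[OF int[OF u]])
    then have "(\<integral>\<omega>. \<bar>\<xi> \<omega>\<bar> powr u \<partial>M) powr (1 / u) \<le> \<psi> u * B"
      using u B \<psi>[OF u] by (subst powr_inverse_le_iff) auto
    then show ?thesis using \<psi>[OF u] by (simp add: field_simps)
  qed
  show "\<xi> \<in> F_space M \<psi>"
    using int q by (auto simp: F_space_def intro!: bdd_aboveI2[where M = B])
  show "F_norm M \<psi> \<xi> \<le> B"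
    unfolding F_norm_def using q by (intro cSUP_least) auto
qed

text \<open>Jensen's inequality with the constant weight \<open>1\<close> and exponent \<open>p / u\<close>.\<close>

lemma (in prob_space) moment_le_higher_moment:
  fixes Y :: "'a \<Rightarrow> real"
  assumes Y [measurable]: "Y \<in> borel_measurable M" and up: "0 < u" "u \<le> p" and b: "0 \<le> b"
    and mom: "(\<integral>\<^sup>+\<omega>. ennreal (\<bar>Y \<omega>\<bar> powr p) \<partial>M) \<le> ennreal (b powr p)"
  shows "(\<integral>\<^sup>+\<omega>. ennreal (\<bar>Y \<omega>\<bar> powr u) \<partial>M) \<le> ennreal (b powr u)"
proof -
  let ?f = "\<lambda>\<omega>. \<bar>Y \<omega>\<bar> powr u"
  have r: "1 \<le> p / u" using up by simp
  have eq: "(\<integral>\<^sup>+\<omega>. ennreal (?f \<omega> powr (p / u)) / ennreal (1 powr (p / u - 1)) \<partial>M)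
      = (\<integral>\<^sup>+\<omega>. ennreal (\<bar>Y \<omega>\<bar> powr p) \<partial>M)"
    using up by (simp add: powr_powr divide_ennreal_def)
  note J = weighted_Jensen[OF r, of ?f M "\<lambda>_. 1", unfolded eq]
  have fin: "(\<integral>\<^sup>+\<omega>. ennreal (\<bar>Y \<omega>\<bar> powr p) \<partial>M) < \<top>"
    by (rule le_less_trans[OF mom ennreal_less_top])
  have int: "integrable M ?f" by (rule J(1)) (use fin in auto)
  let ?E = "expectation ?f"
  have "ennreal (?E powr (p / u)) \<le> ennreal ((\<integral>\<omega>. 1 \<partial>M) powr (p / u - 1)) *
      (\<integral>\<^sup>+\<omega>. ennreal (\<bar>Y \<omega>\<bar> powr p) \<partial>M)"
    by (rule J(2)) (use fin in auto)
  also have "\<dots> \<le> ennreal (b powr p)" using mom by (simp add: prob_space)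
  finally have "?E powr (p / u) \<le> b powr p" by simp
  then have "(?E powr (p / u)) powr (u / p) \<le> (b powr p) powr (u / p)"
    using up by (intro powr_mono2) auto
  then have "?E \<le> b powr u" using up by (simp add: powr_powr)
  then show ?thesis by (simp add: nn_integral_eq_integral[OF int] ennreal_leI)
qed

lemma (in prob_space) tail_le_moment:
  fixes Y :: "'a \<Rightarrow> real"
  assumes Y [measurable]: "Y \<in> borel_measurable M" and u: "0 < u" and \<epsilon>: "0 < \<epsilon>" and b: "0 \<le> b"
    and mom: "(\<integral>\<^sup>+\<omega>. ennreal (\<bar>Y \<omega>\<bar> powr u) \<partial>M) \<le> ennreal (b powr u)"
  shows "prob {\<omega> \<in> space M. Y \<omega> > \<epsilon>} \<le> b powr u / \<epsilon> powr u"
proof -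
  have int: "integrable M (\<lambda>\<omega>. \<bar>Y \<omega>\<bar> powr u)"
    by (rule integrableI_nonneg) (use le_less_trans[OF mom ennreal_less_top] in auto)
  have "prob {\<omega> \<in> space M. Y \<omega> > \<epsilon>} \<le> prob {\<omega> \<in> space M. \<bar>Y \<omega>\<bar> powr u \<ge> \<epsilon> powr u}"
    using u \<epsilon> by (intro finite_measure_mono) (auto intro!: powr_mono2)
  also have "\<dots> \<le> expectation (\<lambda>\<omega>. \<bar>Y \<omega>\<bar> powr u) / \<epsilon> powr u"
    using \<epsilon> by (intro integral_Markov_inequality_measure[OF int sets.empty_sets]) auto
  also have "\<dots> \<le> b powr u / \<epsilon> powr u"
    using mom by (intro divide_right_mono) (auto simp: nn_integral_eq_integral[OF int])
  finally show ?thesis .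
qed

section \<open>The norm of the paths\<close>

theorem theorem8p1:
  fixes M :: "'b measure"
    and T :: "'a::metric_space set"
    and \<nu> :: "'a measure"
    and \<psi> :: "real \<Rightarrow> real"
    and X :: "'a \<Rightarrow> 'b \<Rightarrow> real"
    and p :: real
  assumes "prob_space M"
    and "\<And>u. 1 \<le> u \<Longrightarrow> 0 < \<psi> u"
    and "mono_on {1..} \<psi>"
    and "continuous_on {1..} \<psi>"
    and "filterlim \<psi> at_top at_top"
    and "compact T"
    and "sets \<nu> = sets (restrict_space borel T)"
    and "sigma_finite_measure \<nu>"
    and "(\<lambda>(t, \<omega>). X t \<omega>) \<in> borel_measurable (\<nu> \<Otimes>\<^sub>M M)"
    and "\<And>t. t \<in> T \<Longrightarrow> X t \<in> F_space M \<psi>"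
    and "1 \<le> p"
    and "integrable \<nu> (\<lambda>t. F_norm M \<psi> (X t) powr p)"
  shows "((AE \<omega> in M. integrable \<nu> (\<lambda>t. \<bar>X t \<omega>\<bar> powr p)) \<and>
          path_Lp_norm \<nu> p X \<in> F_space M \<psi> \<and>
          F_norm M \<psi> (path_Lp_norm \<nu> p X)
            \<le> \<psi> p / \<psi> 1 * (\<integral>t. F_norm M \<psi> (X t) powr p \<partial>\<nu>) powr (1 / p)) \<and>
         (\<forall>\<epsilon>>0. measure M {\<omega> \<in> space M. path_Lp_norm \<nu> p X \<omega> > \<epsilon>}
            \<le> (INF u\<in>{1..}. (\<psi> p / \<psi> 1) powr u
                  * (\<integral>t. F_norm M \<psi> (X t) powr p \<partial>\<nu>) powr (u / p)
                  * \<psi> u powr u / \<epsilon> powr u))"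
proof -
  interpret M: prob_space M by fact
  interpret \<nu>: sigma_finite_measure \<nu> by fact
  note \<psi> = assms(2) and X [measurable] = assms(9) and XF = assms(10) and p = assms(11)
    and int = assms(12)
  have space: "space \<nu> = T"
    using sets_eq_imp_space_eq[OF assms(7)] by (simp add: space_restrict_space)
  define A where "A = (\<integral>t. F_norm M \<psi> (X t) powr p \<partial>\<nu>)"
  define B where "B = \<psi> p / \<psi> 1 * A powr (1 / p)"
  define Y where "Y = path_Lp_norm \<nu> p X"
  have A0: "0 \<le> A" by (simp add: A_def)
  have \<psi>p: "0 < \<psi> p" and \<psi>1: "0 < \<psi> 1" using \<psi> p by auto
  have mono: "\<psi> u \<le> \<psi> v" if "1 \<le> u" "u \<le> v" for u v
    using assms(3) that by (auto simp: mono_on_def)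
  have B0: "0 \<le> B" using \<psi>p \<psi>1 by (simp add: B_def)
  have Y0: "0 \<le> Y \<omega>" for \<omega> by (simp add: Y_def path_Lp_norm_def)
  have swap: "(\<lambda>(\<omega>, t). \<bar>X t \<omega>\<bar> powr p) \<in> borel_measurable (M \<Otimes>\<^sub>M \<nu>)"
    using measurable_compose[OF measurable_pair_swap' X] by (simp add: case_prod_beta)
  have Ym [measurable]: "Y \<in> borel_measurable M"
    unfolding Y_def path_Lp_norm_def[abs_def]
    using \<nu>.borel_measurable_lebesgue_integral[OF swap] by measurable

  \<comment> \<open>Minkowski's inequality with exponent \<open>u / p\<close>; the case \<open>u = p\<close> supplies the integrability of
      the paths.\<close>
  have hi: "(AE \<omega> in M. integrable \<nu> (\<lambda>t. \<bar>X t \<omega>\<bar> powr p)) \<and>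
      (\<integral>\<^sup>+\<omega>. ennreal (\<bar>Y \<omega>\<bar> powr u) \<partial>M) \<le> ennreal ((\<psi> u * A powr (1 / p)) powr u)"
    if u: "p \<le> u" for u
  proof -
    have u1: "1 \<le> u" using u p by simp
    have r: "1 \<le> u / p" using u p by simp
    let ?g = "\<lambda>t. (\<psi> u * F_norm M \<psi> (X t)) powr p"
    have geq: "?g t = \<psi> u powr p * F_norm M \<psi> (X t) powr p" if "t \<in> space \<nu>" for t
      using \<psi>[OF u1] F_space_moment_le(1)[OF \<psi> XF u1, of t] that space by (simp add: powr_mult)
    have g: "integrable \<nu> ?g"
      using int by (simp add: geq cong: Bochner_Integration.integrable_cong)
    have G: "(\<integral>t. ?g t \<partial>\<nu>) = \<psi> u powr p * A"
      by (simp add: geq A_def cong: Bochner_Integration.integral_cong)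
    have mom: "(\<integral>\<^sup>+\<omega>. ennreal ((\<bar>X t \<omega>\<bar> powr p) powr (u / p)) \<partial>M) \<le> ennreal (?g t powr (u / p))"
      if "t \<in> space \<nu>" for t
      using F_space_moment_le(2)[OF \<psi> XF u1, of t] that space p by (simp add: powr_powr)
    have fm: "(\<lambda>(t, \<omega>). \<bar>X t \<omega>\<bar> powr p) \<in> borel_measurable (\<nu> \<Otimes>\<^sub>M M)" by measurable
    note Mk = Minkowski_integral_bound[OF assms(8) M.sigma_finite_measure_axioms r fm _ g _ mom, simplified]
    have "(\<integral>\<^sup>+\<omega>. ennreal (\<bar>Y \<omega>\<bar> powr u) \<partial>M)
        = (\<integral>\<^sup>+\<omega>. ennreal ((\<integral>t. \<bar>X t \<omega>\<bar> powr p \<partial>\<nu>) powr (u / p)) \<partial>M)"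
      using p by (simp add: Y_def path_Lp_norm_def powr_powr)
    also have "\<dots> \<le> ennreal ((\<psi> u powr p * A) powr (u / p))"
      using Mk(2) by (simp add: G)
    also have "(\<psi> u powr p * A) powr (u / p) = (\<psi> u * A powr (1 / p)) powr u"
      using \<psi>[OF u1] A0 p by (simp add: powr_mult powr_powr)
    finally show ?thesis using Mk(1) by simp
  qed
  have mom: "(\<integral>\<^sup>+\<omega>. ennreal (\<bar>Y \<omega>\<bar> powr u) \<partial>M) \<le> ennreal ((\<psi> u * B) powr u)" if u: "1 \<le> u" for u
  proof (cases "p \<le> u")
    case True
    have "1 \<le> \<psi> p / \<psi> 1" using mono[of 1 p] p \<psi>1 by simp
    then have "A powr (1 / p) \<le> B"
      unfolding B_def by (metis mult_right_mono mult_1 powr_ge_zero)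
    then have "(\<psi> u * A powr (1 / p)) powr u \<le> (\<psi> u * B) powr u"
      using u \<psi>[OF u] by (intro powr_mono2 mult_left_mono) auto
    with hi[OF True] show ?thesis
      by (meson ennreal_leI order.trans)
  next
    case False
    have "(\<integral>\<^sup>+\<omega>. ennreal (\<bar>Y \<omega>\<bar> powr u) \<partial>M) \<le> ennreal ((\<psi> p * A powr (1 / p)) powr u)"
      using M.moment_le_higher_moment[OF Ym, of u p] hi[of p] False u \<psi>p by auto
    also have "\<dots> \<le> ennreal ((\<psi> u * B) powr u)"
    proof (intro ennreal_leI powr_mono2)
      have "\<psi> p * A powr (1 / p) = \<psi> 1 * B" using \<psi>1 by (simp add: B_def)
      also have "\<dots> \<le> \<psi> u * B" using mono[of 1 u] u B0 by (intro mult_right_mono) auto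
      finally show "\<psi> p * A powr (1 / p) \<le> \<psi> u * B" .
    qed (use u \<psi>p in auto)
    finally show ?thesis .
  qed
  have tail: "M.prob {\<omega> \<in> space M. Y \<omega> > \<epsilon>}
      \<le> (INF u\<in>{1..}. (\<psi> p / \<psi> 1) powr u * A powr (u / p) * \<psi> u powr u / \<epsilon> powr u)"
    if "0 < \<epsilon>" for \<epsilon>
  proof (rule cINF_greatest)
    fix u :: real assume "u \<in> {1..}"
    then have u: "1 \<le> u" by simp
    have "M.prob {\<omega> \<in> space M. Y \<omega> > \<epsilon>} \<le> (\<psi> u * B) powr u / \<epsilon> powr u"
      using M.tail_le_moment[OF Ym _ that _ mom[OF u]] u B0 \<psi>[OF u] by simp
    also have "(\<psi> u * B) powr u = (\<psi> p / \<psi> 1) powr u * A powr (u / p) * \<psi> u powr u"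
      unfolding B_def using \<psi>[OF u] \<psi>p \<psi>1 by (simp add: powr_mult powr_powr powr_divide)
    finally show "M.prob {\<omega> \<in> space M. Y \<omega> > \<epsilon>}
      \<le> (\<psi> p / \<psi> 1) powr u * A powr (u / p) * \<psi> u powr u / \<epsilon> powr u" .
  qed auto
  show ?thesis
    using hi[of p] F_spaceI_moment_le[OF \<psi> Ym B0 mom] tail
    unfolding Y_def B_def A_def by blast
qed

end
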